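(* Let $A_k(x)=\sum_{\pi\in\mathfrak{S}_k}x^{\mathrm{des}(\pi)}$, and define $\widetilde{A}_0(x)=1$, $\widetilde{A}_n(x)=1+x\sum_{k=1}^{n}\binom{n}{k}A_k(x)$ for $n\ge1$. Then for all $n\ge 1$, $$\widetilde{A}_n(x)=\sum_{j=1}^{n}\binom{n}{j}(x-1)^{j-1}\widetilde{A}_{n-j}(x)+x^n,$$ equivalently $\widetilde{A}_n(x)=\sum_{k=0}^{n-1}\binom{n}{k}(x-1)^{n-k-1}\widetilde{A}_k(x)+x^n$.
   Context: $\mathfrak{S}_k$ is the symmetric group on $[k]$; $\mathrm{des}(\pi)$ is the number of $i\in[k-1]$ with $\pi(i)>\pi(i+1)$. *)

theory Defs
  imports "HOL-Computational_Algebra.Polynomial" "HOL-Combinatorics.Permutations"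
begin

abbreviation X :: "int poly" where
  "X \<equiv> [:0, 1:]"

definition des :: "nat \<Rightarrow> (nat \<Rightarrow> nat) \<Rightarrow> nat" where
  "des k p = card {i \<in> {1..<k}. p i > p (i + 1)}"

definition eulerian_poly :: "nat \<Rightarrow> int poly" where
  "eulerian_poly k = (\<Sum>p | p permutes {1..k}. X ^ des k p)"

definition binomial_eulerian_poly :: "nat \<Rightarrow> int poly" where
  "binomial_eulerian_poly n =
     (if n = 0 then 1
      else 1 + X * (\<Sum>k = 1..n. of_nat (n choose k) * eulerian_poly k))"

end

theory Submission
  imports Defs "HOL-Combinatorics.Multiset_Permutations"
begin

text \<open>
  Mark an arbitrary set of descents with weight \<open>x - 1\<close> each and split a word after its first
  maximal block of marked descents: that block is an arbitrary nonempty set written in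
  decreasing order, the rest is an arbitrary word. Hence
  \<open>A\<^sub>n = (\<Sum>j\<ge>1. (n choose j) (x - 1)\<^sup>j\<^sup>-\<^sup>1 A\<^sub>n\<^sub>-\<^sub>j)\<close> for \<open>n \<ge> 1\<close>.
  The operator \<open>S\<close> applied to \<open>A\<close> here is a binomial convolution, so it commutes with the
  binomial transform. The binomial Eulerian polynomials are the transform of
  \<open>g = x A - (x - 1) \<delta>\<^sub>0\<close>, and \<open>S g = g - (x - 1)\<^sup>k\<close>; the transform of \<open>(x - 1)\<^sup>k\<close> is \<open>x\<^sup>n\<close>.
\<close>

section \<open>Descents of words and their initial decreasing blocks\<close>

fun list_des :: "'a::linorder list \<Rightarrow> nat" where
  "list_des (a # b # xs) = of_bool (b < a) + list_des (b # xs)"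
| "list_des xs = 0"

text \<open>The possible lengths of the first marked block: a block of length \<open>j\<close> uses
  up \<open>j - 1\<close> marked descents, and \<open>j = 1\<close> means that the first gap is
  unmarked.\<close>

definition decreasing_prefixes :: "'a::linorder list \<Rightarrow> nat set" where
  "decreasing_prefixes xs = {j \<in> {1..length xs}. sorted_wrt (>) (take j xs)}"

lemma finite_decreasing_prefixes [simp]: "finite (decreasing_prefixes xs)"
  by (simp add: decreasing_prefixes_def)

lemma sorted_wrt_greater_take_Cons_Cons:
  fixes a b :: "'a::linorder"
  assumes "j \<ge> 1"
  shows "sorted_wrt (>) (take (Suc j) (a # b # xs)) \<longleftrightarrow> b < a \<and> sorted_wrt (>) (take j (b # xs))"
proof -
  obtain i where "j = Suc i"
    using assms by (metis One_nat_def Suc_le_D)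
  then show ?thesis
    by (auto dest: order.strict_trans)
qed

lemma decreasing_prefixes_singleton: "decreasing_prefixes [a] = {1}"
  by (auto simp: decreasing_prefixes_def)

lemma decreasing_prefixes_Cons_Cons:
  "decreasing_prefixes (a # b # xs) =
     insert 1 (if b < a then Suc ` decreasing_prefixes (b # xs) else {})"
proof -
  have "Suc j \<in> decreasing_prefixes (a # b # xs) \<longleftrightarrow>
          j = 0 \<or> b < a \<and> j \<in> decreasing_prefixes (b # xs)" for j
    by (cases "j = 0")
      (auto simp: decreasing_prefixes_def sorted_wrt_greater_take_Cons_Cons simp del: take_Suc_Cons,
       auto)
  moreover have "0 \<notin> decreasing_prefixes (a # b # xs)"
    by (simp add: decreasing_prefixes_def)
  ultimately have "j \<in> decreasing_prefixes (a # b # xs) \<longleftrightarrow>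
      j \<in> insert 1 (if b < a then Suc ` decreasing_prefixes (b # xs) else {})" for j
    by (cases j) auto
  then show ?thesis
    by blast
qed

text \<open>If the word starts with a descent, write \<open>x * y = y + (x - 1) * y\<close> with
  \<open>y = x ^ list_des (b # xs)\<close>: the first summand is the term \<open>j = 1\<close>, the
  second is the induction hypothesis with every block lengthened by \<open>a\<close>. Otherwise only
  \<open>j = 1\<close> occurs.\<close>

lemma power_list_des_decreasing_prefixes:
  fixes x :: "'b::comm_ring_1"
  assumes "xs \<noteq> []"
  shows "x ^ list_des xs =
           (\<Sum>j\<in>decreasing_prefixes xs. (x - 1) ^ (j - 1) * x ^ list_des (drop j xs))"
  using assms
proof (induction xs rule: list_des.induct)
  case (1 a b xs)
  let ?P = "decreasing_prefixes (b # xs)"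
  have "(\<Sum>j\<in>Suc ` ?P. (x - 1) ^ (j - 1) * x ^ list_des (drop j (a # b # xs))) =
          (\<Sum>j\<in>?P. (x - 1) ^ j * x ^ list_des (drop j (b # xs)))"
    by (subst sum.reindex) (auto simp: inj_on_def)
  also have "\<dots> = (x - 1) * (\<Sum>j\<in>?P. (x - 1) ^ (j - 1) * x ^ list_des (drop j (b # xs)))"
    unfolding sum_distrib_left
  proof (rule sum.cong)
    fix j assume "j \<in> ?P"
    then show "(x - 1) ^ j * x ^ list_des (drop j (b # xs)) =
        (x - 1) * ((x - 1) ^ (j - 1) * x ^ list_des (drop j (b # xs)))"
      \<comment> \<open>Prefix lengths are positive, so the truncated \<open>j - 1\<close> loses
        nothing.\<close>
      by (cases j) (simp_all only: decreasing_prefixes_def power_Suc mult.assoc, simp_all)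
  qed simp
  also have "\<dots> = (x - 1) * x ^ list_des (b # xs)"
    using 1 by simp
  finally have *: "(\<Sum>j\<in>Suc ` ?P. (x - 1) ^ (j - 1) * x ^ list_des (drop j (a # b # xs))) =
                     (x - 1) * x ^ list_des (b # xs)" .
  have "1 \<notin> Suc ` ?P"
    by (auto simp: decreasing_prefixes_def)
  with * show ?case
    by (simp add: decreasing_prefixes_Cons_Cons left_diff_distrib)
qed (simp_all add: decreasing_prefixes_singleton)

section \<open>Recursion for the descent sum over the arrangements of a set\<close>

definition des_sum :: "'b::comm_ring_1 \<Rightarrow> 'a::linorder set \<Rightarrow> 'b" where
  "des_sum x U = (\<Sum>xs\<in>permutations_of_set U. x ^ list_des xs)"

text \<open>A decreasing block can be recovered from its set of letters, so in
  \<open>des_sum_rec\<close> it may be replaced by that set.\<close>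

lemma rev_sorted_list_of_set_unique:
  fixes xs :: "'a::linorder list"
  assumes "sorted_wrt (>) xs"
  shows "rev (sorted_list_of_set (set xs)) = xs"
proof -
  have "sorted_wrt (<) (rev xs)"
    using assms by (simp add: sorted_wrt_rev)
  then have "sorted_list_of_set (set (rev xs)) = rev xs"
    by (metis finite_set set_sorted_list_of_set strict_sorted_equal strict_sorted_list_of_set)
  then show ?thesis
    by simp
qed

lemma des_sum_rec:
  fixes U :: "'a::linorder set"
  assumes "finite U" "U \<noteq> {}"
  shows "des_sum x U = (\<Sum>T\<in>Pow U - {{}}. (x - 1) ^ (card T - 1) * des_sum x (U - T))"
proof -
  let ?w = "\<lambda>j ys. (x - 1) ^ (j - 1) * x ^ list_des ys"
  have "des_sum x U =
          (\<Sum>xs\<in>permutations_of_set U. \<Sum>j\<in>decreasing_prefixes xs. ?w j (drop j xs))"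
    unfolding des_sum_def using assms
    by (intro sum.cong refl power_list_des_decreasing_prefixes) (auto simp: permutations_of_set_def)
  also have "\<dots> = (\<Sum>(xs, j)\<in>(SIGMA xs:permutations_of_set U. decreasing_prefixes xs).
                      ?w j (drop j xs))"
    by (subst sum.Sigma) auto
  also have "\<dots> = (\<Sum>(T, ys)\<in>(SIGMA T:Pow U - {{}}. permutations_of_set (U - T)).
                      ?w (card T) ys)"
  \<comment> \<open>Cut the word after \<open>j\<close> letters and forget the order of the first
    piece; the inverse writes \<open>T\<close> in decreasing order in front. The block length
    \<open>j\<close> becomes \<open>card T\<close>.\<close>
  proof (rule sum.reindex_bij_witness
      [where j = "\<lambda>(xs, j). (set (take j xs), drop j xs)"
         and i = "\<lambda>(T, ys). (rev (sorted_list_of_set T) @ ys, card T)"], goal_cases)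
    case (1 p)
    then show ?case
      by (auto simp: permutations_of_set_def decreasing_prefixes_def rev_sorted_list_of_set_unique
          distinct_card)
  next
    case (2 p)
    then obtain xs j where p: "p = (xs, j)" "distinct xs" "set xs = U" "j \<in> decreasing_prefixes xs"
      by (auto simp: permutations_of_set_def)
    have "set (take j xs) \<union> set (drop j xs) = U" "set (take j xs) \<inter> set (drop j xs) = {}"
      using p by (metis append_take_drop_id set_append, metis append_take_drop_id distinct_append)
    moreover have "take j xs \<noteq> []"
      using p by (auto simp: decreasing_prefixes_def)
    ultimately show ?case
      using p by (auto simp: permutations_of_set_def)
  next
    case (3 q)
    then obtain T ys where q: "q = (T, ys)" "T \<subseteq> U" "T \<noteq> {}" "ys \<in> permutations_of_set (U - T)"
      by auto
    then have "finite T"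
      using assms finite_subset by blast
    with q show ?case by simp
  next
    case (4 q)
    then obtain T ys where q: "q = (T, ys)" "T \<subseteq> U" "T \<noteq> {}" "distinct ys" "set ys = U - T"
      by (auto simp: permutations_of_set_def)
    then have "finite T"
      using assms finite_subset by blast
    moreover from this have "card T \<ge> 1"
      using q by (simp add: Suc_le_eq card_gt_0_iff)
    ultimately show ?case using q
      by (auto simp: permutations_of_set_def decreasing_prefixes_def sorted_wrt_rev)
  next
    case (5 p)
    then show ?case
      by (auto simp: permutations_of_set_def decreasing_prefixes_def distinct_card)
  qed
  also have "\<dots> = (\<Sum>T\<in>Pow U - {{}}. \<Sum>ys\<in>permutations_of_set (U - T). ?w (card T) ys)"
    using assms by (subst sum.Sigma) auto
  finally show ?thesis
    by (simp add: des_sum_def sum_distrib_left)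
qed

lemma sum_nonempty_subsets_card:
  fixes h :: "nat \<Rightarrow> 'b::comm_semiring_1"
  assumes "finite U"
  shows "(\<Sum>T\<in>Pow U - {{}}. h (card T)) = (\<Sum>j = 1..card U. of_nat (card U choose j) * h j)"
proof -
  have "(\<Sum>T\<in>Pow U - {{}}. h (card T)) =
          (\<Sum>j = 1..card U. \<Sum>T\<in>{T \<in> Pow U - {{}}. card T = j}. h (card T))"
  proof (rule sum.group [symmetric])
    show "card ` (Pow U - {{}}) \<subseteq> {1..card U}"
      using assms by (auto simp: card_mono Suc_le_eq card_gt_0_iff dest: finite_subset)
  qed (use assms in auto)
  also have "\<dots> = (\<Sum>j = 1..card U. of_nat (card U choose j) * h j)"
  proof (rule sum.cong)
    fix j assume "j \<in> {1..card U}"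
    then have "{T \<in> Pow U - {{}}. card T = j} = {T. T \<subseteq> U \<and> card T = j}"
      by auto
    then show "(\<Sum>T\<in>{T \<in> Pow U - {{}}. card T = j}. h (card T)) = of_nat (card U choose j) * h j"
      using assms by (simp add: n_subsets)
  qed simp
  finally show ?thesis .
qed

section \<open>From permutations to words, and the recursion for Eulerian polynomials\<close>

lemma list_des_map_upt:
  "list_des (map p [m..<n]) = card {i \<in> {m..<n - 1}. p (Suc i) < p i}"
proof (induction "n - m" arbitrary: m)
  case 0
  then show ?case by simp
next
  case (Suc d)
  show ?case
  proof (cases "Suc m < n")
    case True
    have "{i \<in> {m..<n - 1}. p (Suc i) < p i} =
            (if p (Suc m) < p m then {m} else {}) \<union> {i \<in> {Suc m..<n - 1}. p (Suc i) < p i}"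
      using True by (auto simp: Suc_le_eq le_less)
    moreover have "list_des (map p [Suc m..<n]) = card {i \<in> {Suc m..<n - 1}. p (Suc i) < p i}"
      using Suc by (intro Suc.hyps) auto
    ultimately show ?thesis
      using True by (simp add: upt_conv_Cons)
  next
    case False
    then have "n = Suc m"
      using Suc by simp
    then show ?thesis by simp
  qed
qed

text \<open>Two permutations with the same word agree on the interval and fix everything else.
  Surjectivity then follows from equal cardinalities.\<close>

lemma bij_betw_permutes_permutations_of_set:
  "bij_betw (\<lambda>p. map p [m..<n]) {p. p permutes {m..<n}} (permutations_of_set {m..<n})"
proof -
  have "inj_on (\<lambda>p. map p [m..<n]) {p. p permutes {m..<n}}"
  proof (rule inj_onI, rule ext)
    fix p q i
    assume "p \<in> {p. p permutes {m..<n}}" "q \<in> {p. p permutes {m..<n}}"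
      "map p [m..<n] = map q [m..<n]"
    then show "p i = q i"
      by (cases "i \<in> {m..<n}") (auto simp: permutes_not_in)
  qed
  moreover have "(\<lambda>p. map p [m..<n]) ` {p. p permutes {m..<n}} \<subseteq> permutations_of_set {m..<n}"
    by (auto simp: permutations_of_set_def distinct_map permutes_inj_on permutes_image
        simp flip: atLeastLessThan_upt)
  moreover have "card {p. p permutes {m..<n}} = card (permutations_of_set {m..<n})"
    by (simp add: card_permutations)
  ultimately show ?thesis
    by (metis bij_betw_def card_image card_subset_eq finite_permutations_of_set)
qed

lemma des_sum_atLeastAtMost: "des_sum X {1..n} = eulerian_poly n"
proof -
  have "des_sum X {1..<Suc n} = (\<Sum>p | p permutes {1..<Suc n}. X ^ list_des (map p [1..<Suc n]))"
    unfolding des_sum_def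
    by (rule sum.reindex_bij_betw [OF bij_betw_permutes_permutations_of_set, symmetric])
  \<comment> \<open>The upper end \<open>Suc n\<close> turns the range in
    \<open>list_des_map_upt\<close> into the \<open>{1..<n}\<close> of \<open>des\<close>.\<close>
  then show ?thesis
    by (simp add: eulerian_poly_def des_def list_des_map_upt atLeastLessThanSuc_atLeastAtMost
        del: upt_Suc)
qed

text \<open>Removing a nonempty \<open>T\<close> leaves a proper subset, so knowing the values there
  suffices; the terms are then grouped by \<open>card T\<close>.\<close>

lemma des_sum_rec_card:
  fixes U :: "'a::linorder set"
  assumes "finite U" "U \<noteq> {}" "\<And>V. V \<subset> U \<Longrightarrow> des_sum x V = a (card V)"
  shows "des_sum x U =
    (\<Sum>j = 1..card U. of_nat (card U choose j) * ((x - 1) ^ (j - 1) * a (card U - j)))"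
proof -
  have "des_sum x (U - T) = a (card U - card T)" if "T \<in> Pow U - {{}}" for T
  proof -
    have "T \<subseteq> U" "finite T" "U - T \<subset> U"
      using that \<open>finite U\<close> finite_subset by auto
    then show ?thesis
      using assms(3) [of "U - T"] by (simp add: card_Diff_subset)
  qed
  then have "des_sum x U = (\<Sum>T\<in>Pow U - {{}}. (x - 1) ^ (card T - 1) * a (card U - card T))"
    using assms by (simp add: des_sum_rec)
  then show ?thesis
    using sum_nonempty_subsets_card [OF \<open>finite U\<close>, of "\<lambda>j. (x - 1) ^ (j - 1) * a (card U - j)"]
    by simp
qed

text \<open>Invariance under relabelling: the recursion only sees the cardinality of the set.\<close>

lemma des_sum_eq_eulerian_poly:
  fixes U :: "nat set"
  assumes "finite U"
  shows "des_sum X U = eulerian_poly (card U)"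
  using assms
proof (induction U rule: measure_induct_rule[where f = card])
  case (less U)
  \<comment> \<open>Stated for every \<open>V\<close> of the given size, so that it compares
    \<open>U\<close> with the standard set \<open>{1..card U}\<close>.\<close>
  have rec: "des_sum X V = (\<Sum>j = 1..card U.
      of_nat (card U choose j) * ((X - 1) ^ (j - 1) * eulerian_poly (card U - j)))"
    if "finite V" "V \<noteq> {}" "card V = card U" for V :: "nat set"
  proof -
    have "des_sum X W = eulerian_poly (card W)" if "W \<subset> V" for W
      using less.IH [of W] that \<open>finite V\<close> \<open>card V = card U\<close>
      by (metis finite_subset psubset_card_mono psubset_imp_subset)
    from des_sum_rec_card [OF that(1,2) this] show ?thesis
      using that(3) by simp
  qed
  show ?case
  proof (cases "U = {}")
    case True
    then show ?thesis
      using des_sum_atLeastAtMost [of 0] by simp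
  next
    case False
    then have "{1..card U} \<noteq> {}"
      using less.prems by (auto simp: Suc_le_eq card_gt_0_iff)
    then have "des_sum X U = des_sum X {1..card U}"
      using rec [of U] rec [of "{1..card U}"] False less.prems by simp
    then show ?thesis
      by (simp only: des_sum_atLeastAtMost)
  qed
qed

lemma eulerian_poly_rec:
  assumes "n \<ge> 1"
  shows "eulerian_poly n =
    (\<Sum>j = 1..n. of_nat (n choose j) * ((X - 1) ^ (j - 1) * eulerian_poly (n - j)))"
proof -
  have "des_sum X V = eulerian_poly (card V)" if "V \<subset> {1..n}" for V
    using that by (intro des_sum_eq_eulerian_poly) (auto intro: finite_subset)
  then have "des_sum X {1..n} =
      (\<Sum>j = 1..n. of_nat (n choose j) * ((X - 1) ^ (j - 1) * eulerian_poly (n - j)))"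
    using des_sum_rec_card [of "{1..n}" X eulerian_poly] assms by simp
  then show ?thesis
    by (simp only: des_sum_atLeastAtMost)
qed

section \<open>Binomial convolution and the binomial transform\<close>

lemma binomial_convolution_assoc:
  fixes f g h :: "nat \<Rightarrow> 'a::comm_semiring_1"
  shows "(\<Sum>j\<le>n. of_nat (n choose j) * f j * (\<Sum>m\<le>n - j. of_nat (n - j choose m) * g m * h (n - j - m))) =
         (\<Sum>k\<le>n. of_nat (n choose k) * (\<Sum>j\<le>k. of_nat (k choose j) * f j * g (k - j)) * h (n - k))"
proof -
  have "(\<Sum>j\<le>n. of_nat (n choose j) * f j * (\<Sum>m\<le>n - j. of_nat (n - j choose m) * g m * h (n - j - m))) =
     (\<Sum>(j, m)\<in>(SIGMA j:{..n}. {..n - j}).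
        of_nat ((n choose j) * (n - j choose m)) * f j * g m * h (n - j - m))"
    by (subst sum.Sigma [symmetric]) (auto simp: sum_distrib_left mult_ac)
  also have "\<dots> = (\<Sum>(k, j)\<in>(SIGMA k:{..n}. {..k}).
        of_nat ((n choose k) * (k choose j)) * f j * g (k - j) * h (n - k))"
  \<comment> \<open>Substitute \<open>k = j + m\<close>. Both products of binomials count the pairs
    of disjoint subsets of sizes \<open>j\<close> and \<open>m\<close> in an
    \<open>n\<close>-set.\<close>
  proof (rule sum.reindex_bij_witness
      [where j = "\<lambda>(j, m). (j + m, j)" and i = "\<lambda>(k, j). (j, k - j)"], goal_cases)
    case (5 p)
    then obtain j m where p: "p = (j, m)" "j + m \<le> n"
      by auto
    then have "(n choose (j + m)) * (j + m choose j) = (n choose j) * (n - j choose m)"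
      using choose_mult [of j "j + m" n] by simp
    then show ?case
      using p by (simp del: of_nat_mult)
  qed auto
  also have "\<dots> = (\<Sum>k\<le>n. of_nat (n choose k) * (\<Sum>j\<le>k. of_nat (k choose j) * f j * g (k - j)) * h (n - k))"
    by (subst sum.Sigma [symmetric]) (auto simp: sum_distrib_left sum_distrib_right mult_ac)
  finally show ?thesis .
qed

theorem theorem2p12:
  fixes n :: nat
  assumes "n \<ge> 1"
  shows "binomial_eulerian_poly n =
           (\<Sum>j = 1..n. of_nat (n choose j) * (X - 1) ^ (j - 1) * binomial_eulerian_poly (n - j))
           + X ^ n
       \<and> binomial_eulerian_poly n =
           (\<Sum>k = 0..n - 1. of_nat (n choose k) * (X - 1) ^ (n - k - 1) * binomial_eulerian_poly k)
           + X ^ n"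
proof -
  \<comment> \<open>Block weights; \<open>s 0 = 0\<close> excludes the empty block and lets the sums
    start at 0, as the convolution lemma requires.\<close>
  define s :: "nat \<Rightarrow> int poly" where "s j = (if j = 0 then 0 else (X - 1) ^ (j - 1))" for j
  define g where "g k = (if k = 0 then 1 else X * eulerian_poly k)" for k
  have A0: "eulerian_poly 0 = 1"
    using des_sum_atLeastAtMost [of 0] by (simp add: des_sum_def)
  have g: "g k = X * eulerian_poly k - (if k = 0 then X - 1 else 0)" for k
    by (simp add: g_def A0 one_pCons)
  have s_sum: "(\<Sum>j\<le>m. of_nat (m choose j) * s j * f (m - j)) =
      (\<Sum>j = 1..m. of_nat (m choose j) * (X - 1) ^ (j - 1) * f (m - j))" for m f
    by (rule sum.mono_neutral_cong_right) (auto simp: s_def)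
  \<comment> \<open>The factor 1 exhibits the binomial transform as convolution with the constant
    sequence 1.\<close>
  have binom: "binomial_eulerian_poly m = (\<Sum>k\<le>m. of_nat (m choose k) * g k * 1)" for m
  proof -
    have "(\<Sum>k\<le>m. of_nat (m choose k) * g k * 1) = 1 + (\<Sum>k = 1..m. of_nat (m choose k) * g k)"
      unfolding atMost_atLeast0 by (subst sum.atLeast_Suc_atMost) (simp_all add: g_def)
    also have "(\<Sum>k = 1..m. of_nat (m choose k) * g k) =
        X * (\<Sum>k = 1..m. of_nat (m choose k) * eulerian_poly k)"
      unfolding sum_distrib_left
      by (rule sum.cong) (simp_all add: g_def mult.left_commute del: mult_pCons_left)
    finally show ?thesis
      by (cases "m = 0") (simp_all add: binomial_eulerian_poly_def)
  qed
  \<comment> \<open>For \<open>k > 0\<close> the part \<open>X * eulerian_poly\<close> is reproduced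
    by the Eulerian recursion, while the correction at 0 survives only for \<open>j = k\<close> and
    gives \<open>(X - 1) ^ k\<close>.\<close>
  have conv_g: "(\<Sum>j\<le>k. of_nat (k choose j) * s j * g (k - j)) = g k - (X - 1) ^ k" for k
  proof (cases "k = 0")
    case True
    then show ?thesis by (simp add: s_def g_def)
  next
    case False
    have "(\<Sum>j\<le>k. of_nat (k choose j) * s j * g (k - j)) =
        X * (\<Sum>j\<le>k. of_nat (k choose j) * s j * eulerian_poly (k - j))
        - (\<Sum>j\<le>k. of_nat (k choose j) * s j * (if k - j = 0 then X - 1 else 0))"
      by (simp add: g algebra_simps sum_distrib_left flip: sum_subtractf)
    also have "(\<Sum>j\<le>k. of_nat (k choose j) * s j * eulerian_poly (k - j)) = eulerian_poly k"
      unfolding s_sum [of k eulerian_poly] using eulerian_poly_rec [of k] False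
      by (simp add: mult.assoc)
    also have "(\<Sum>j\<le>k. of_nat (k choose j) * s j * (if k - j = 0 then X - 1 else 0)) =
        (\<Sum>j\<in>{k}. of_nat (k choose j) * s j * (X - 1))"
      by (rule sum.mono_neutral_cong_right) auto
    also have "\<dots> = (X - 1) ^ k"
      using False by (cases k) (simp_all add: s_def mult_ac)
    finally show ?thesis
      using False by (simp add: g_def)
  qed
  \<comment> \<open>Associativity moves the convolution with \<open>s\<close> inside the transform,
    where \<open>conv_g\<close> evaluates it.\<close>
  have "(\<Sum>j\<le>n. of_nat (n choose j) * s j * binomial_eulerian_poly (n - j)) =
      (\<Sum>k\<le>n. of_nat (n choose k) * (g k - (X - 1) ^ k) * 1)"
    using binomial_convolution_assoc [of n s g "\<lambda>_. 1"] by (simp only: binom conv_g)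
  also have "\<dots> = binomial_eulerian_poly n - (\<Sum>k\<le>n. of_nat (n choose k) * (X - 1) ^ k * 1 ^ (n - k))"
    by (simp add: binom algebra_simps flip: sum_subtractf)
  also have "(\<Sum>k\<le>n. of_nat (n choose k) * (X - 1) ^ k * 1 ^ (n - k)) = X ^ n"
    using binomial_ring [of "X - 1" 1 n] by simp
  finally have 1: "binomial_eulerian_poly n =
      (\<Sum>j = 1..n. of_nat (n choose j) * (X - 1) ^ (j - 1) * binomial_eulerian_poly (n - j)) + X ^ n"
    unfolding s_sum [of n binomial_eulerian_poly] by simp
  \<comment> \<open>Reversal \<open>k = n - j\<close>, under which
    \<open>n - k - 1 = j - 1\<close>.\<close>
  have "(\<Sum>j = 1..n. of_nat (n choose j) * (X - 1) ^ (j - 1) * binomial_eulerian_poly (n - j)) =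
      (\<Sum>k = 0..n - 1. of_nat (n choose k) * (X - 1) ^ (n - k - 1) * binomial_eulerian_poly k)"
    using assms
    by (intro sum.reindex_bij_witness [where i = "\<lambda>k. n - k" and j = "\<lambda>j. n - j"])
      (auto simp flip: binomial_symmetric)
  with 1 show ?thesis
    by simp
qed

end
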